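(* There exist absolute constants $C, c > 0$ and $n_0$ such that for all $n \geq n_0$ and all $k$ the following holds. Let $\lambda$ be any value with $\lambda < \sqrt[3]{n}$, and let $\mathbf{c} = (c_1,\dots,c_k)$ be any initial $k$-color configuration on $n$ nodes (with $c_1 \geq c_2 \geq \dots \geq c_k$) such that $c_1 \geq n/\lambda$ and $s(\mathbf{c}) = c_1 - c_2 \geq 24\sqrt{2\lambda\, n\log n}$. Then, with probability at least $1 - n^{-c}$, the 3-majority protocol started from $\mathbf{c}$ reaches the configuration in which all $n$ nodes have the plurality color $1$ within at most $C\lambda \log n$ rounds. (That is, the process converges to the plurality color in $\mathcal{O}(\lambda \log n)$ time with high probability.)
   Context: A $k$-color configuration on $n$ nodes is a $k$-tuple $\mathbf{c}=(c_1,\dots,c_k)$ of non-negative integers with $\sum_{j} c_j = n$, where $c_j$ is the number of nodes with color $j\in[k]=\{1,\dots,k\}$. Colors are indexed so that in the initial configuration $c_1\geq c_2\geq\dots\geq c_k$; color $1$ is the plurality color and $s(\mathbf{c})=c_1-c_2$ is the bias. 3-majority protocol (on the clique, synchronous rounds): at every round, every node, independently of the others, picks three nodes uniformly at random (including itself and with repetitions) and recolors itself according to the majority of the colors it sees; if it sees three different colors, it chooses the first one. All nodes update simultaneously, using the colors at the beginning of the round. "With high probability" means with probability at least $1-n^{-c}$ for some constant $c>0$ and all sufficiently large $n$. $\log$ is the natural logarithm. *)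

theory Defs
  imports "HOL-Probability.Probability" "HOL-Library.Monad_Syntax"
begin

text \<open>
  The nodes are \<open>0, \<dots>, n - 1\<close>. A coloring is a function from nodes to colors, of which only
  the values on \<open>{..<n}\<close> matter. A \<open>k\<close>-color configuration is a function \<open>c\<close> with \<open>c j\<close> the
  number of nodes of color \<open>j\<close>; colors are numbered from \<open>1\<close>, and \<open>c\<close> is \<open>0\<close> off \<open>{1..k}\<close>.
\<close>

type_synonym coloring = "nat \<Rightarrow> nat"
type_synonym configuration = "nat \<Rightarrow> nat"

definition is_configuration :: "nat \<Rightarrow> nat \<Rightarrow> configuration \<Rightarrow> bool" where
  "is_configuration n k c \<longleftrightarrow> (\<forall>j. j \<notin> {1..k} \<longrightarrow> c j = 0) \<and> (\<Sum>j\<in>{1..k}. c j) = n"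

definition configuration_of :: "nat \<Rightarrow> coloring \<Rightarrow> configuration" where
  "configuration_of n x = (\<lambda>j. card {v \<in> {..<n}. x v = j})"

text \<open>For \<open>k = 1\<close> we have \<open>c 2 = 0\<close>, so the bias is then \<open>c 1\<close>.\<close>

definition bias :: "configuration \<Rightarrow> real" where
  "bias c = real (c 1) - real (c 2)"

definition maj3 :: "nat \<Rightarrow> nat \<Rightarrow> nat \<Rightarrow> nat" where
  "maj3 a b d = (if a = b \<or> a = d then a else if b = d then b else a)"

definition node_update :: "nat \<Rightarrow> coloring \<Rightarrow> nat pmf" where
  "node_update n x = do {
     u \<leftarrow> pmf_of_set {..<n};
     v \<leftarrow> pmf_of_set {..<n};
     w \<leftarrow> pmf_of_set {..<n};
     return_pmf (maj3 (x u) (x v) (x w))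
   }"

text \<open>
  \<open>Pi_pmf\<close> draws the new colors of the nodes independently; off \<open>{..<n}\<close> the new coloring has the
  irrelevant default value \<open>0\<close>.
\<close>

definition majority_round :: "nat \<Rightarrow> coloring \<Rightarrow> coloring pmf" where
  "majority_round n x = Pi_pmf {..<n} 0 (\<lambda>_. node_update n x)"

text \<open>
  The law of the sequence of the \<open>T + 1\<close> colorings at times \<open>0, \<dots>, T\<close> of the protocol started
  from \<open>x\<close>.
\<close>

fun trajectory :: "nat \<Rightarrow> nat \<Rightarrow> coloring \<Rightarrow> coloring list pmf" where
  "trajectory n 0 x = return_pmf [x]"
| "trajectory n (Suc T) x = do {
     y \<leftarrow> majority_round n x;
     xs \<leftarrow> trajectory n T y;
     return_pmf (x # xs)
   }"

end

theory Submission
  imports Defs "HOL-Real_Asymp.Real_Asymp"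
begin

text \<open>
  A node adopts colour \<open>j\<close> with probability \<open>f\<^sub>j (1 + f\<^sub>j - S)\<close>, where \<open>f\<^sub>j = c\<^sub>j / n\<close> and
  \<open>S = \<Sum>h. f\<^sub>h\<^sup>2\<close>. If \<open>c\<^sub>1\<close> exceeds every other count by \<open>s\<close>, then \<open>S \<le> f\<^sub>1 - (s/n) (1 - f\<^sub>1)\<close>; hence
  the expected gap to every other colour is at least \<open>s (1 + f\<^sub>1 (1 - f\<^sub>1))\<close> and the expected value of \<open>c\<^sub>1\<close>
  is at least \<open>c\<^sub>1 + s f\<^sub>1 (1 - f\<^sub>1)\<close>. All counts have variance at most \<open>2 c\<^sub>1\<close>, so by a Chernoff bound they
  deviate by at most \<open>d = \<surd>(32 c\<^sub>1 ln n)\<close> except with probability \<open>n\<^sup>-\<^sup>4\<close>, and the assumptions on \<open>c\<^sub>1\<close> and on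
  the bias give \<open>6 d \<le> s f\<^sub>1\<close>. So while \<open>f\<^sub>1 \<le> 3/5\<close>, each round multiplies the gap by
  \<open>1 + f\<^sub>1/15 \<ge> 1 + 1/(15\<lambda>)\<close>, without decreasing \<open>c\<^sub>1\<close>; as the gap is at most \<open>n\<close>, this phase ends within
  \<open>O(\<lambda> ln n)\<close> rounds. Once \<open>f\<^sub>1 \<ge> 3/5\<close>, this persists and the number of nodes of other colours shrinks in
  expectation by the factor \<open>22/25\<close> per round, so by Markov's inequality it vanishes after \<open>O(ln n)\<close> rounds.
\<close>

section \<open>A Chernoff bound for colour counts\<close>

lemma exp_minus_mult_ln:
  fixes x :: real
  assumes "x > 0"
  shows "exp (- (real k * ln x)) = 1 / x ^ k"
  using assms by (simp add: exp_minus exp_of_nat_mult inverse_eq_divide)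

text \<open>Both Chernoff tails use this one quadratic. For negative \<open>s = - y\<close> it
  follows by inverting the Taylor bound \<open>exp y \<ge> 1 + y + y\<^sup>2 / 2\<close>, since the
  product of the two quadratics is at least 1.\<close>

lemma exp_le_one_plus_quadratic:
  fixes s :: real
  assumes "\<bar>s\<bar> \<le> 1"
  shows "exp s \<le> 1 + s + s\<^sup>2"
proof (cases "s \<ge> 0")
  case True
  then show ?thesis using assms by (intro exp_bound) auto
next
  case False
  define y where "y = - s"
  have y: "y \<ge> 0" using False by (simp add: y_def)
  have "(1 - y + y\<^sup>2) * (1 + y + y\<^sup>2 / 2) = 1 + y\<^sup>2 / 2 + y ^ 3 / 2 + y ^ 4 / 2"
    by (simp add: field_simps power2_eq_square power3_eq_cube power4_eq_xxxx)
  then have *: "1 \<le> (1 - y + y\<^sup>2) * (1 + y + y\<^sup>2 / 2)"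
    using y by simp
  have "0 \<le> 1 - y + y\<^sup>2"
  proof -
    have "1 - y + y\<^sup>2 = (y - 1/2)\<^sup>2 + 3/4" by (simp add: power2_eq_square field_simps)
    then show ?thesis by simp
  qed
  then have "(1 - y + y\<^sup>2) * (1 + y + y\<^sup>2 / 2) \<le> (1 - y + y\<^sup>2) * exp y"
    using exp_lower_Taylor_quadratic[OF y] by (intro mult_left_mono)
  with * have "1 \<le> (1 - y + y\<^sup>2) * exp y" by linarith
  then have "exp (- y) \<le> 1 - y + y\<^sup>2"
    by (simp add: exp_minus field_simps)
  then show ?thesis by (simp add: y_def)
qed

text \<open>The exponential of a count is a product with one factor per node, \<open>exp t\<close>
  if the node has colour \<open>j\<close> and 1 otherwise; by independence the expectation
  factorises.\<close>

lemma expectation_exp_count_Pi_pmf: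
  fixes t :: real
  assumes "finite A"
  shows "measure_pmf.expectation (Pi_pmf A dflt (\<lambda>_. q)) (\<lambda>y. exp (t * real (card {v \<in> A. y v = j}))) =
    (1 + pmf q j * (exp t - 1)) ^ card A"
proof -
  define f where "f = (\<lambda>a. 1 + (exp t - 1) * indicator {j} a :: real)"
  have f_nonneg: "f a \<ge> 0" for a by (simp add: f_def indicator_def)
  have int: "integrable (measure_pmf q) f"
    unfolding f_def by (intro Bochner_Integration.integrable_add integrable_mult_right
      integrable_real_indicator) (auto simp: measure_pmf.emeasure_eq_measure)
  have eq: "exp (t * real (card {v \<in> A. y v = j})) = (\<Prod>v\<in>A. f (y v))" for y
  proof -
    have "(\<Prod>v\<in>A. f (y v)) = (\<Prod>v\<in>A. if y v = j then exp t else 1)"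
      by (intro prod.cong) (auto simp: f_def)
    also have "\<dots> = (\<Prod>v\<in>{v \<in> A. y v = j}. exp t)"
      using assms by (simp add: prod.If_cases Int_def)
    finally show ?thesis by (simp add: exp_of_nat_mult[symmetric] mult.commute)
  qed
  have "measure_pmf.expectation (Pi_pmf A dflt (\<lambda>_. q)) (\<lambda>y. \<Prod>v\<in>A. f (y v)) =
      (\<Prod>v\<in>A. measure_pmf.expectation q f)"
    using expectation_prod_Pi_pmf[of A "\<lambda>_. q" "\<lambda>_. f" dflt] assms int f_nonneg by blast
  also have "measure_pmf.expectation q f = 1 + pmf q j * (exp t - 1)"
  proof -
    have "measure_pmf.expectation q f = 1 + (exp t - 1) * measure q {j}"
      unfolding f_def by (subst Bochner_Integration.integral_add)
        (auto intro!: integrable_mult_right integrable_real_indicator simp: measure_pmf.emeasure_eq_measure)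
    then show ?thesis by (simp add: measure_pmf_single)
  qed
  finally show ?thesis by (simp add: eq)
qed

text \<open>Exponential Markov inequality; the sign \<open>\<sigma>\<close> selects the tail. As
  \<open>M\<close> need only bound the mean from above, rare colours get the same deviation bound as
  frequent ones.\<close>

lemma count_Pi_pmf_chernoff:
  fixes M d \<sigma> :: real
  assumes A: "finite A" and mean: "real (card A) * pmf q j \<le> M"
    and M: "M > 0" and d: "0 \<le> d" "d \<le> 2 * M" and \<sigma>: "\<bar>\<sigma>\<bar> = 1"
  shows "measure_pmf.prob (Pi_pmf A dflt (\<lambda>_. q))
      {y. \<sigma> * (real (card {v \<in> A. y v = j}) - real (card A) * pmf q j) \<ge> d} \<le> exp (- d\<^sup>2 / (4 * M))"
proof -
  let ?P = "Pi_pmf A dflt (\<lambda>_. q)" and ?X = "\<lambda>y. real (card {v \<in> A. y v = j})"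
  define \<mu> where "\<mu> = real (card A) * pmf q j"
  \<comment> \<open>Minimiser of \<open>M * t\<^sup>2 - t * d\<close>. The assumption
    \<open>d \<le> 2 * M\<close> keeps \<open>t \<le> 1\<close>, within the range of the quadratic
    bound.\<close>
  define t where "t = d / (2 * M)"
  have t: "0 \<le> t" "t \<le> 1" using M d by (auto simp: t_def field_simps)
  have \<sigma>2: "\<sigma>\<^sup>2 = 1" using \<sigma> by (metis power2_abs one_power2)
  have \<mu>: "0 \<le> \<mu>" "\<mu> \<le> M" using mean by (auto simp: \<mu>_def)
  have bound: "(1 + pmf q j * (exp (t * \<sigma>) - 1)) ^ card A \<le> exp (\<mu> * (t * \<sigma> + t\<^sup>2))"
  proof -
    have "exp (t * \<sigma>) \<le> 1 + t * \<sigma> + (t * \<sigma>)\<^sup>2"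
      using t \<sigma> by (intro exp_le_one_plus_quadratic) (simp add: abs_mult)
    then have "exp (t * \<sigma>) - 1 \<le> t * \<sigma> + t\<^sup>2" by (simp add: power_mult_distrib \<sigma>2)
    then have "pmf q j * (exp (t * \<sigma>) - 1) \<le> pmf q j * (t * \<sigma> + t\<^sup>2)"
      by (intro mult_left_mono) auto
    then have "1 + pmf q j * (exp (t * \<sigma>) - 1) \<le> exp (pmf q j * (t * \<sigma> + t\<^sup>2))"
      by (smt (verit) exp_ge_add_one_self)
    moreover have "0 \<le> 1 + pmf q j * (exp (t * \<sigma>) - 1)"
    proof -
      have "pmf q j * (1 - exp (t * \<sigma>)) \<le> 1 * 1"
        by (rule order_trans[OF mult_left_mono[of "1 - exp (t * \<sigma>)" 1]]) (auto simp: pmf_le_1)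
      then show ?thesis by (simp add: algebra_simps)
    qed
    ultimately have "(1 + pmf q j * (exp (t * \<sigma>) - 1)) ^ card A \<le> exp (pmf q j * (t * \<sigma> + t\<^sup>2)) ^ card A"
      by (intro power_mono)
    also have "\<dots> = exp (\<mu> * (t * \<sigma> + t\<^sup>2))"
      by (simp add: \<mu>_def exp_of_nat_mult[symmetric] mult.assoc)
    finally show ?thesis .
  qed
  have integrable: "integrable (measure_pmf ?P) (\<lambda>y. exp (t * \<sigma> * ?X y))"
  proof (rule measure_pmf.integrable_const_bound[where B = "exp (real (card A))"])
    have "t * \<sigma> * ?X y \<le> real (card A)" for y
    proof -
      have "?X y \<le> real (card A)" using A by (simp add: card_mono)
      moreover have "t * \<sigma> \<le> 1" using t \<sigma> by (cases "\<sigma> = 1") (auto simp: abs_if split: if_splits)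
      ultimately show ?thesis
        by (smt (verit, ccfv_SIG) mult_left_le_one_le mult_nonneg_nonneg mult_right_mono of_nat_0_le_iff)
    qed
    then show "AE y in ?P. norm (exp (t * \<sigma> * ?X y)) \<le> exp (real (card A))" by simp
  qed simp
  have "measure_pmf.prob ?P {y. \<sigma> * (?X y - \<mu>) \<ge> d} \<le>
      measure_pmf.prob ?P {y. exp (t * \<sigma> * ?X y) \<ge> exp (t * (d + \<sigma> * \<mu>))}"
  proof (intro measure_pmf.finite_measure_mono)
    have "t * (d + \<sigma> * \<mu>) \<le> t * \<sigma> * ?X y" if "\<sigma> * (?X y - \<mu>) \<ge> d" for y
    proof -
      have "t * (d + \<sigma> * \<mu>) \<le> t * (\<sigma> * ?X y)"
        using that t by (intro mult_left_mono) (auto simp: algebra_simps)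
      then show ?thesis by (simp add: mult.assoc)
    qed
    then show "{y. \<sigma> * (?X y - \<mu>) \<ge> d} \<subseteq> {y. exp (t * \<sigma> * ?X y) \<ge> exp (t * (d + \<sigma> * \<mu>))}"
      by auto
  qed simp
  also have "\<dots> \<le> measure_pmf.expectation ?P (\<lambda>y. exp (t * \<sigma> * ?X y)) / exp (t * (d + \<sigma> * \<mu>))"
    using integral_Markov_inequality_measure[OF integrable, of "{}" "exp (t * (d + \<sigma> * \<mu>))"]
    by simp
  also have "\<dots> \<le> exp (\<mu> * (t * \<sigma> + t\<^sup>2)) / exp (t * (d + \<sigma> * \<mu>))"
    using bound by (simp add: expectation_exp_count_Pi_pmf[OF A] divide_right_mono)
  \<comment> \<open>The terms linear in \<open>\<mu>\<close> cancel; the mean survives only in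
    \<open>\<mu> * t\<^sup>2\<close>, where \<open>M\<close> may replace it.\<close>
  also have "\<dots> = exp (\<mu> * t\<^sup>2 - t * d)"
    by (simp add: exp_diff[symmetric] algebra_simps)
  also have "\<dots> \<le> exp (M * t\<^sup>2 - t * d)"
    using \<mu> by (simp add: mult_right_mono)
  also have "M * t\<^sup>2 - t * d = - d\<^sup>2 / (4 * M)"
    using M by (simp add: t_def field_simps power2_eq_square)
  finally show ?thesis by (simp add: \<mu>_def)
qed

section \<open>The drift of one round\<close>

abbreviation cnt :: "nat \<Rightarrow> coloring \<Rightarrow> nat \<Rightarrow> real" where
  "cnt n x j \<equiv> real (configuration_of n x j)"

text \<open>The number of ordered pairs of nodes of equal colour, i.e. \<open>\<Sum>j. c\<^sub>j\<^sup>2\<close>, written without a sum over colours.\<close>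

definition collisions :: "nat \<Rightarrow> coloring \<Rightarrow> real" where
  "collisions n x = (\<Sum>v<n. cnt n x (x v))"

lemma sum_indicator_color: "(\<Sum>v<n. if x v = j then 1 else 0) = cnt n x j"
  by (simp add: configuration_of_def Int_def flip: sum.inter_filter)

lemma pmf_node_update:
  assumes n: "n > 0"
  shows "real n * pmf (node_update n x) j = cnt n x j * (1 + cnt n x j / real n - collisions n x / (real n)\<^sup>2)"
proof -
  have ne: "{..<n} \<noteq> {}" using n by auto
  let ?\<delta> = "\<lambda>i. if i = j then 1 else (0::real)"
  \<comment> \<open>With \<open>a\<close> sampled first, the majority is \<open>j\<close> iff \<open>b = d = j\<close> or \<open>a = j\<close> and \<open>b \<noteq> d\<close>;
    in this form the triple sum factorises.\<close>
  have ind: "pmf (return_pmf (maj3 a b d)) j =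
      ?\<delta> a - ?\<delta> a * (if d = b then 1 else 0) + ?\<delta> b * ?\<delta> d" for a b d
    by (auto simp: maj3_def)
  have "pmf (node_update n x) j =
      (\<Sum>u<n. (\<Sum>v<n. (\<Sum>w<n. pmf (return_pmf (maj3 (x u) (x v) (x w))) j) / real n) / real n) / real n"
    unfolding node_update_def using ne by (simp add: pmf_bind_pmf_of_set del: pmf_return)
  also have "\<dots> = (\<Sum>u<n. \<Sum>v<n. \<Sum>w<n. pmf (return_pmf (maj3 (x u) (x v) (x w))) j) / real n ^ 3"
    by (simp add: sum_divide_distrib[symmetric] power3_eq_cube)
  also have "(\<Sum>u<n. \<Sum>v<n. \<Sum>w<n. pmf (return_pmf (maj3 (x u) (x v) (x w))) j) =
      cnt n x j * real n * real n - cnt n x j * collisions n x + real n * (cnt n x j * cnt n x j)"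
    unfolding ind
    by (simp add: sum.distrib sum_subtractf sum_distrib_left[symmetric] sum_distrib_right[symmetric]
        sum_indicator_color collisions_def)
  finally have eq: "pmf (node_update n x) j = (cnt n x j * real n * real n - cnt n x j * collisions n x
    + real n * (cnt n x j * cnt n x j)) / real n ^ 3" .
  show ?thesis unfolding eq using n by (simp add: field_simps power2_eq_square power3_eq_cube)
qed

lemma configuration_of_le: "configuration_of n x j \<le> n"
  using card_mono[of "{..<n}" "{v \<in> {..<n}. x v = j}"] by (auto simp: configuration_of_def)

lemma cnt_le: "cnt n x j \<le> real n"
  by (simp add: configuration_of_le)

lemma cnt_add_le: "i \<noteq> j \<Longrightarrow> cnt n x i + cnt n x j \<le> real n"
proof -
  assume "i \<noteq> j"
  then have "card {v \<in> {..<n}. x v = i} + card {v \<in> {..<n}. x v = j} =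
      card ({v \<in> {..<n}. x v = i} \<union> {v \<in> {..<n}. x v = j})"
    by (subst card_Un_disjoint) auto
  also have "\<dots> \<le> card {..<n}" by (intro card_mono) auto
  finally show ?thesis by (simp add: configuration_of_def flip: of_nat_add)
qed

lemma collisions_nonneg: "0 \<le> collisions n x"
  by (simp add: collisions_def sum_nonneg)

lemma collisions_le_square: "collisions n x \<le> (real n)\<^sup>2"
proof -
  have "collisions n x \<le> (\<Sum>v<n. real n)"
    unfolding collisions_def by (intro sum_mono cnt_le)
  then show ?thesis by (simp add: power2_eq_square)
qed

text \<open>Each node contributes the count of its own colour: \<open>c\<^sub>1\<close> for a node
  of colour 1, at most \<open>c\<^sub>1 - s\<close> for any other.\<close>

lemma collisions_le:
  assumes "\<And>j. j \<noteq> 1 \<Longrightarrow> cnt n x j \<le> cnt n x 1 - s"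
  shows "collisions n x \<le> real n * (cnt n x 1 - s) + s * cnt n x 1"
proof -
  have "collisions n x \<le> (\<Sum>v<n. (cnt n x 1 - s) + s * (if x v = 1 then 1 else 0))"
    unfolding collisions_def
  proof (intro sum_mono)
    fix v show "cnt n x (x v) \<le> (cnt n x 1 - s) + s * (if x v = 1 then 1 else 0)"
      using assms[of "x v"] by (cases "x v = 1") simp_all
  qed
  also have "\<dots> = real n * (cnt n x 1 - s) + s * cnt n x 1"
    by (simp add: sum.distrib sum_distrib_left[symmetric] sum_indicator_color[of x 1 n, simplified])
  finally show ?thesis .
qed

definition expected_cnt :: "nat \<Rightarrow> coloring \<Rightarrow> nat \<Rightarrow> real" where
  "expected_cnt n x j = real n * pmf (node_update n x) j"

lemma expected_cnt_nonneg: "0 \<le> expected_cnt n x j"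
  by (simp add: expected_cnt_def)

lemma expected_cnt_eq:
  "n > 0 \<Longrightarrow> expected_cnt n x j = cnt n x j * (1 + cnt n x j / real n - collisions n x / (real n)\<^sup>2)"
  by (simp add: expected_cnt_def pmf_node_update)

lemma expected_cnt_le:
  assumes n: "n > 0"
  shows "expected_cnt n x j \<le> 2 * cnt n x j"
proof -
  have "cnt n x j / real n \<le> 1" using cnt_le[of n x j] n by (simp add: field_simps)
  moreover have "0 \<le> collisions n x / (real n)\<^sup>2" by (simp add: collisions_nonneg)
  ultimately have "cnt n x j * (1 + cnt n x j / real n - collisions n x / (real n)\<^sup>2) \<le> cnt n x j * 2"
    by (intro mult_left_mono) auto
  then show ?thesis using n by (simp add: expected_cnt_eq mult.commute)
qed

lemma expected_cnt_plurality_ge: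
  assumes n: "n > 0" and gap: "\<And>j. j \<noteq> 1 \<Longrightarrow> cnt n x j \<le> cnt n x 1 - s"
  defines "f \<equiv> cnt n x 1 / real n"
  shows "expected_cnt n x 1 \<ge> cnt n x 1 + s * f * (1 - f)"
proof -
  have "collisions n x / (real n)\<^sup>2 \<le> (real n * (cnt n x 1 - s) + s * cnt n x 1) / (real n)\<^sup>2"
    using collisions_le[OF gap] by (intro divide_right_mono) auto
  then have "cnt n x 1 * (1 + cnt n x 1 / real n - collisions n x / (real n)\<^sup>2) \<ge>
      cnt n x 1 * (1 + cnt n x 1 / real n - (real n * (cnt n x 1 - s) + s * cnt n x 1) / (real n)\<^sup>2)"
    by (intro mult_left_mono) auto
  also have "cnt n x 1 * (1 + cnt n x 1 / real n - (real n * (cnt n x 1 - s) + s * cnt n x 1) / (real n)\<^sup>2)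
      = cnt n x 1 + s * f * (1 - f)"
    using n by (simp add: f_def field_simps power2_eq_square)
  finally show ?thesis using n by (simp add: expected_cnt_eq)
qed

text \<open>For \<open>Q \<le> 1\<close> the map \<open>t \<mapsto> t * (1 - Q + t / N)\<close> is
  increasing on \<open>t \<ge> 0\<close>, so the worst rival has exactly \<open>a - s\<close> nodes.
  The difference of the two values then factors as
  \<open>s * (1 - Q + (2 * a - s) / N)\<close>.\<close>

lemma expected_cnt_gap_ge:
  assumes n: "n > 0" and s: "s \<ge> 0" and gap: "\<And>j. j \<noteq> 1 \<Longrightarrow> cnt n x j \<le> cnt n x 1 - s"
    and j: "j \<noteq> 1"
  defines "f \<equiv> cnt n x 1 / real n"
  shows "expected_cnt n x 1 - expected_cnt n x j \<ge> s * (1 + f * (1 - f))"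
proof -
  define N where "N = real n"
  define a where "a = cnt n x 1"
  define Q where "Q = collisions n x / N\<^sup>2"
  have N: "N > 0" using n by (simp add: N_def)
  have ja: "cnt n x j \<le> a - s" using gap[OF j] by (simp add: a_def)
  then have sa: "s \<le> a" "0 \<le> a - s" by linarith+
  have Q1: "Q \<le> 1" using collisions_le_square[of n x] n by (simp add: Q_def N_def field_simps)
  have "Q \<le> (N * (a - s) + s * a) / N\<^sup>2"
    unfolding Q_def N_def a_def using collisions_le[OF gap] by (intro divide_right_mono) auto
  also have "\<dots> = (a - s) / N + s * f / N"
    using N by (simp add: f_def a_def N_def field_simps power2_eq_square)
  \<comment> \<open>Since a rival's count is non-negative, \<open>s \<le> a\<close>. This makes the
    bound on \<open>Q\<close> fit the factor \<open>1 - Q + (2 * a - s) / N\<close>, where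
    \<open>(a - s) / N\<close> cancels.\<close>
  also have "s * f / N \<le> a * f / N"
    using sa N by (intro divide_right_mono mult_right_mono) (auto simp: f_def)
  also have "a * f / N = f * f" by (simp add: f_def a_def N_def)
  finally have Q2: "Q \<le> (a - s) / N + f * f" by simp
  have "expected_cnt n x j = cnt n x j * ((1 - Q) + cnt n x j / N)"
    using n by (simp add: expected_cnt_eq Q_def N_def algebra_simps)
  also have "\<dots> \<le> (a - s) * ((1 - Q) + (a - s) / N)"
    using ja sa N Q1 by (intro mult_mono add_left_mono divide_right_mono) auto
  finally have 1: "expected_cnt n x j \<le> (a - s) * ((1 - Q) + (a - s) / N)" .
  have 2: "expected_cnt n x 1 = a * ((1 - Q) + a / N)"
    using n by (simp add: expected_cnt_eq Q_def N_def a_def algebra_simps)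
  have "a * ((1 - Q) + a / N) - (a - s) * ((1 - Q) + (a - s) / N) = s * ((1 - Q) + a / N + (a - s) / N)"
    using N by (simp add: field_simps)
  also have "\<dots> \<ge> s * (1 + f * (1 - f))"
  proof (intro mult_left_mono s)
    show "1 + f * (1 - f) \<le> 1 - Q + a / N + (a - s) / N"
      using Q2 by (simp add: f_def a_def N_def algebra_simps)
  qed
  finally show ?thesis using 1 2 by linarith
qed

section \<open>Support, concentration and mean of one round\<close>

lemma set_pmf_node_update: "n > 0 \<Longrightarrow> set_pmf (node_update n x) \<subseteq> x ` {..<n}"
proof -
  assume "n > 0"
  then have "{..<n} \<noteq> {}" by auto
  then show ?thesis by (auto simp: node_update_def maj3_def split: if_splits)
qed

lemma finite_set_majority_round: "n > 0 \<Longrightarrow> finite (set_pmf (majority_round n x))"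
  unfolding majority_round_def
  by (subst set_Pi_pmf) (auto intro!: finite_PiE_dflt finite_subset[OF set_pmf_node_update])

text \<open>Extinct colours stay extinct, so the later union bound runs over at most
  \<open>n\<close> colours, whatever \<open>k\<close> is.\<close>

lemma cnt_majority_round_absent:
  assumes "n > 0" "y \<in> set_pmf (majority_round n x)" "j \<notin> x ` {..<n}"
  shows "cnt n y j = 0"
proof -
  have "y v \<in> x ` {..<n}" if "v < n" for v
    using assms(2) that set_pmf_node_update[OF assms(1), of x]
    by (auto simp: majority_round_def set_Pi_pmf PiE_dflt_def)
  with assms(3) have "{v \<in> {..<n}. y v = j} = {}" by auto
  then show ?thesis by (simp add: configuration_of_def)
qed

lemma majority_round_chernoff:
  assumes "expected_cnt n x j \<le> M" "M > 0" "0 \<le> d" "d \<le> 2 * M" "\<bar>\<sigma>\<bar> = 1"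
  shows "measure_pmf.prob (majority_round n x) {y. \<sigma> * (cnt n y j - expected_cnt n x j) \<ge> d}
    \<le> exp (- d\<^sup>2 / (4 * M))"
  using count_Pi_pmf_chernoff[of "{..<n}" "node_update n x" j M d \<sigma> 0] assms
  by (simp add: majority_round_def configuration_of_def expected_cnt_def)

lemma expectation_cnt_majority_round:
  assumes n: "n > 0"
  shows "measure_pmf.expectation (majority_round n x) (\<lambda>y. cnt n y j) = expected_cnt n x j"
proof -
  let ?P = "majority_round n x"
  have "measure_pmf.expectation ?P (\<lambda>y. cnt n y j) =
      measure_pmf.expectation ?P (\<lambda>y. \<Sum>v<n. indicator {j} (y v) :: real)"
    by (simp add: indicator_def of_bool_def flip: sum_indicator_color)
  also have "\<dots> = (\<Sum>v<n. measure_pmf.expectation ?P (\<lambda>y. indicator {j} (y v)))"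
    by (intro Bochner_Integration.integral_sum integrable_measure_pmf_finite finite_set_majority_round n)
  also have "\<dots> = (\<Sum>v<n. pmf (node_update n x) j)"
  proof (intro sum.cong refl)
    fix v assume "v \<in> {..<n}"
    then have eq: "node_update n x = map_pmf (\<lambda>y. y v) ?P"
      by (simp add: majority_round_def Pi_pmf_component)
    have "measure_pmf.expectation ?P (\<lambda>y. indicator {j} (y v)) =
      measure_pmf.expectation (map_pmf (\<lambda>y. y v) ?P) (indicator {j} :: nat \<Rightarrow> real)"
      by (rule integral_map_pmf[symmetric])
    also have "\<dots> = pmf (node_update n x) j"
      by (simp add: measure_pmf_single flip: eq)
    finally show "measure_pmf.expectation ?P (\<lambda>y. indicator {j} (y v)) = pmf (node_update n x) j" .
  qed
  finally show ?thesis by (simp add: expected_cnt_def)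
qed

section \<open>Convergence\<close>

definition miss :: "nat \<Rightarrow> nat \<Rightarrow> coloring \<Rightarrow> real" where
  "miss n T x = measure_pmf.prob (trajectory n T x) {xs. \<forall>y\<in>set xs. configuration_of n y 1 \<noteq> n}"

lemma prob_trajectory_eq:
  "measure_pmf.prob (trajectory n T x) {xs. \<exists>y\<in>set xs. configuration_of n y 1 = n} = 1 - miss n T x"
  using measure_pmf.prob_compl[of "{xs. \<forall>y\<in>set xs. configuration_of n y 1 \<noteq> n}" "trajectory n T x"]
  by (simp add: miss_def Compl_eq_Diff_UNIV[symmetric] Collect_neg_eq[symmetric])

lemma miss_le_one: "miss n T x \<le> 1"
  by (simp add: miss_def)

lemma miss_0: "miss n 0 x = (if configuration_of n x 1 = n then 0 else 1)"
  by (simp add: miss_def)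

text \<open>Markov property at the first round. Dropping the condition on the initial colouring
  \<open>x\<close> enlarges the event, hence an inequality.\<close>

lemma miss_Suc_le: "miss n (Suc T) x \<le> measure_pmf.expectation (majority_round n x) (miss n T)"
proof -
  let ?R = "majority_round n x" and ?B = "{xs. \<forall>y\<in>set xs. configuration_of n y 1 \<noteq> n}"
  have int: "integrable (measure_pmf ?R) (miss n T)"
    by (rule measure_pmf.integrable_const_bound[where B = 1]) (auto simp: miss_def)
  have "ennreal (miss n (Suc T) x) = emeasure (trajectory n (Suc T) x) ?B"
    by (simp add: miss_def measure_pmf.emeasure_eq_measure)
  also have "trajectory n (Suc T) x = ?R \<bind> (\<lambda>y. map_pmf ((#) x) (trajectory n T y))"
    by (simp add: map_pmf_def)
  also have "emeasure \<dots> ?B = (\<integral>\<^sup>+y. emeasure (map_pmf ((#) x) (trajectory n T y)) ?B \<partial>?R)"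
    by simp
  also have "\<dots> \<le> (\<integral>\<^sup>+y. ennreal (miss n T y) \<partial>?R)"
  proof (intro nn_integral_mono)
    fix y
    have "emeasure (map_pmf ((#) x) (trajectory n T y)) ?B \<le> emeasure (trajectory n T y) ?B"
      by (subst emeasure_map_pmf, rule emeasure_mono) auto
    then show "emeasure (map_pmf ((#) x) (trajectory n T y)) ?B \<le> ennreal (miss n T y)"
      by (simp add: miss_def measure_pmf.emeasure_eq_measure)
  qed
  also have "\<dots> = ennreal (measure_pmf.expectation ?R (miss n T))"
    by (intro nn_integral_eq_integral int) (simp add: miss_def)
  finally show ?thesis
    by (simp add: ennreal_le_iff integral_nonneg miss_def)
qed

text \<open>Common induction step of both phases: failure is bounded by 1 off \<open>G\<close> and
  by \<open>g\<close> on \<open>G\<close>. Letting \<open>g\<close> depend on the new colouring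
  allows a potential that contracts only on average.\<close>

lemma miss_step:
  assumes n: "n > 0" and bad: "measure_pmf.prob (majority_round n x) (- G) \<le> \<epsilon>"
    and good: "\<And>y. y \<in> G \<Longrightarrow> miss n T y \<le> g y" and g: "\<And>y. 0 \<le> g y"
  shows "miss n (Suc T) x \<le> \<epsilon> + measure_pmf.expectation (majority_round n x) g"
proof -
  let ?R = "majority_round n x"
  note int = integrable_measure_pmf_finite[OF finite_set_majority_round[OF n]]
  have "miss n (Suc T) x \<le> measure_pmf.expectation ?R (miss n T)" by (rule miss_Suc_le)
  also have "\<dots> \<le> measure_pmf.expectation ?R (\<lambda>y. indicator (- G) y + g y)"
  proof (intro integral_mono int)
    fix y show "miss n T y \<le> indicator (- G) y + g y"
      using good[of y] g[of y] miss_le_one[of n T y] by (auto simp: indicator_def)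
  qed
  also have "\<dots> = measure_pmf.prob ?R (- G) + measure_pmf.expectation ?R g"
    by (subst Bochner_Integration.integral_add[OF int int]) simp
  finally show ?thesis using bad by linarith
qed

section \<open>One-round estimates for the endgame and the growth phase, and their iteration\<close>

lemma consensus_round:
  assumes n: "n > 0" "6000 * ln (real n) \<le> real n" and x: "cnt n x 1 \<ge> 3/5 * real n"
  shows "measure_pmf.prob (majority_round n x) (- {y. cnt n y 1 \<ge> 3/5 * real n}) \<le> 1 / real n ^ 3"
    and "measure_pmf.expectation (majority_round n x) (\<lambda>y. real n - cnt n y 1) \<le> 22/25 * (real n - cnt n x 1)"
proof -
  define N where "N = real n"
  define f where "f = cnt n x 1 / N"
  have N: "N > 0" using n by (simp add: N_def)
  have f: "3/5 \<le> f" "f \<le> 1" using x cnt_le[of n x 1] N by (auto simp: f_def N_def field_simps)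
  have c: "cnt n x 1 = f * N" using N by (simp add: f_def)
  \<comment> \<open>Above \<open>n/2\<close> the bias is at least \<open>2 c\<^sub>1 - n\<close>, however the other nodes are coloured.\<close>
  have "cnt n x j \<le> cnt n x 1 - (2 * cnt n x 1 - N)" if "j \<noteq> 1" for j
    using cnt_add_le[OF that, of n x] by (simp add: N_def)
  from expected_cnt_plurality_ge[OF n(1) this]
  have "expected_cnt n x 1 \<ge> f * N + (2 * (f * N) - N) * f * (1 - f)"
    using n by (simp add: f_def N_def)
  also have "(2 * (f * N) - N) * f * (1 - f) = (2 * f - 1) * f * ((1 - f) * N)"
    by (simp add: algebra_simps)
  finally have "expected_cnt n x 1 \<ge> f * N + (2 * f - 1) * f * ((1 - f) * N)" .
  moreover have "(2 * f - 1) * f * ((1 - f) * N) \<ge> 3/25 * ((1 - f) * N)"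
  proof (rule mult_right_mono)
    have "(1/5) * (3/5) \<le> (2 * f - 1) * f" using f by (intro mult_mono) auto
    then show "3/25 \<le> (2 * f - 1) * f" by simp
  qed (use f N in auto)
  ultimately have m: "N - expected_cnt n x 1 \<le> 22/25 * ((1 - f) * N)"
    using left_diff_distrib[of 1 f N] by linarith
  also have "\<dots> \<le> 22/25 * (2/5 * N)" using f N by (intro mult_left_mono mult_right_mono) auto
  \<comment> \<open>From \<open>1 - f \<le> 2/5\<close> the expected minority is at most
    \<open>44/125 * N\<close>, so the mean of colour 1 exceeds the threshold \<open>3/5 * N\<close>
    by \<open>6/125 * N\<close>.\<close>
  finally have m': "expected_cnt n x 1 \<ge> 81/125 * N" by simp
  have mN: "expected_cnt n x 1 \<le> N" by (simp add: expected_cnt_def N_def pmf_le_1 mult_left_le)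
  have "measure_pmf.prob (majority_round n x) (- {y. cnt n y 1 \<ge> 3/5 * real n}) \<le>
     measure_pmf.prob (majority_round n x) {y. -1 * (cnt n y 1 - expected_cnt n x 1) \<ge> 6/125 * N}"
    using m' by (intro measure_pmf.finite_measure_mono) (auto simp: N_def)
  also have "\<dots> \<le> exp (- (6/125 * N)\<^sup>2 / (4 * N))"
    using N mN by (intro majority_round_chernoff) auto
  also have "- (6/125 * N)\<^sup>2 / (4 * N) = - (9/15625) * N" using N by (simp add: power2_eq_square)
  \<comment> \<open>The constant 6000 is large enough: \<open>6000 * 9 / 15625 > 3\<close>.\<close>
  also have "exp (- (9/15625) * N) \<le> exp (- (3 * ln N))"
    using n by (auto simp: N_def)
  also have "\<dots> = 1 / N ^ 3"
    using N exp_minus_mult_ln[of N 3] by simp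
  finally show "measure_pmf.prob (majority_round n x) (- {y. cnt n y 1 \<ge> 3/5 * real n}) \<le> 1 / real n ^ 3"
    by (simp add: N_def)
  have "measure_pmf.expectation (majority_round n x) (\<lambda>y. real n - cnt n y 1) = N - expected_cnt n x 1"
    by (subst Bochner_Integration.integral_diff)
      (auto intro!: integrable_measure_pmf_finite finite_set_majority_round n
        simp: expectation_cnt_majority_round[OF n(1)] N_def)
  then show "measure_pmf.expectation (majority_round n x) (\<lambda>y. real n - cnt n y 1) \<le> 22/25 * (real n - cnt n x 1)"
    using m left_diff_distrib[of 1 f N] c by (simp add: N_def)
qed

text \<open>With high probability colour 1 falls short of its mean, and every other colour exceeds
  its mean, by at most \<open>d\<close>. The expected growth of the gap then outweighs the loss of
  \<open>2 * d\<close>.\<close>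

lemma bias_round:
  assumes n: "n > 1" and s: "s \<ge> 0" and gap: "\<And>j. j \<noteq> 1 \<Longrightarrow> cnt n x j \<le> cnt n x 1 - s"
  defines "f \<equiv> cnt n x 1 / real n"
  assumes f: "f \<le> 3/5" and c: "2 * ln (real n) \<le> cnt n x 1"
    and noise: "6 * sqrt (32 * cnt n x 1 * ln (real n)) \<le> s * f"
  shows "measure_pmf.prob (majority_round n x)
    (- {y. cnt n y 1 \<ge> cnt n x 1 \<and> (\<forall>j. j \<noteq> 1 \<longrightarrow> cnt n y j \<le> cnt n y 1 - s * (1 + f / 15))}) \<le> 2 / real n ^ 3"
proof -
  let ?R = "majority_round n x"
  define N where "N = real n"
  define a where "a = cnt n x 1"
  \<comment> \<open>With mean bound \<open>M = 2 * a\<close> the Chernoff exponent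
    \<open>d\<^sup>2 / (4 * M)\<close> is \<open>4 * ln N\<close>. The tails
    \<open>N\<^sup>-\<^sup>4\<close>, over at most \<open>N\<close> colours and once more for the
    lower tail of colour 1, sum to at most \<open>2 / N ^ 3\<close>.\<close>
  define d where "d = sqrt (32 * a * ln N)"
  have N: "N > 1" and n0: "n > 0" using n by (auto simp: N_def)
  then have lnN: "ln N > 0" by simp
  then have a: "a > 0" "2 * ln N \<le> a" using c by (auto simp: a_def N_def)
  have d2: "d\<^sup>2 = 32 * a * ln N" using a lnN by (simp add: d_def)
  have d0: "d \<ge> 0" using a lnN by (simp add: d_def)
  have f0: "f \<ge> 0" by (simp add: f_def)
  have dd: "6 * d \<le> s * f" using noise by (simp add: d_def a_def N_def)
  have "d\<^sup>2 \<le> (4 * a)\<^sup>2"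
    unfolding d2 using mult_left_mono[of "2 * ln N" a "16 * a"] a by (simp add: power2_eq_square)
  then have d4: "d \<le> 2 * (2 * a)" using a power2_le_imp_le[of d "4 * a"] by simp
  have tail: "measure_pmf.prob ?R {y. \<sigma> * (cnt n y j - expected_cnt n x j) \<ge> d} \<le> 1 / N ^ 4"
    if "\<bar>\<sigma>\<bar> = 1" for \<sigma> j
  proof -
    have "cnt n x j \<le> a" using gap[of j] s by (cases "j = 1") (auto simp: a_def)
    then have "expected_cnt n x j \<le> 2 * a" using expected_cnt_le[OF n0, of x j] by linarith
    then have "measure_pmf.prob ?R {y. \<sigma> * (cnt n y j - expected_cnt n x j) \<ge> d} \<le> exp (- d\<^sup>2 / (4 * (2 * a)))"
      using a d0 d4 that by (intro majority_round_chernoff) auto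
    also have "- d\<^sup>2 / (4 * (2 * a)) = - (4 * ln N)" using a by (simp add: d2)
    also have "exp \<dots> = 1 / N ^ 4"
      using N exp_minus_mult_ln[of N 4] by simp
    finally show ?thesis .
  qed
  define A where "A = {y. - 1 * (cnt n y 1 - expected_cnt n x 1) \<ge> d}"
  define B where "B = (\<lambda>j. {y. 1 * (cnt n y j - expected_cnt n x j) \<ge> d})"
  have good: "cnt n y 1 \<ge> a \<and> (\<forall>j. j \<noteq> 1 \<longrightarrow> cnt n y j \<le> cnt n y 1 - s * (1 + f / 15))"
    if y: "y \<in> set_pmf ?R" and "y \<notin> A" and B: "y \<notin> (\<Union>j\<in>x ` {..<n}. B j)" for y
  proof -
    have y1: "cnt n y 1 \<ge> expected_cnt n x 1 - d" using \<open>y \<notin> A\<close> by (auto simp: A_def)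
    have yj: "cnt n y j \<le> expected_cnt n x j + d" for j
    proof (cases "j \<in> x ` {..<n}")
      case True
      with B have "y \<notin> B j" by blast
      then show ?thesis by (auto simp: B_def)
    next
      case False
      then show ?thesis using cnt_majority_round_absent[OF n0 y] expected_cnt_nonneg[of n x j] d0 by auto
    qed
    have sf: "s * f \<ge> 0" using s f0 by simp
    \<comment> \<open>Origin of the rate \<open>f / 15\<close>: the drift is at least
      \<open>2/5 * s * f\<close>, the noise \<open>2 * d\<close> at most \<open>1/3 * s * f\<close>,
      and \<open>2/5 - 1/3 = 1/15\<close>.\<close>
    have q: "s * f * (1 - f) \<ge> s * f * (2/5)" using f by (intro mult_left_mono sf) auto
    have "expected_cnt n x 1 \<ge> a + s * f * (1 - f)"
      using expected_cnt_plurality_ge[OF n0 gap] by (simp add: f_def a_def)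
    then have "cnt n y 1 \<ge> a" using y1 dd d0 q by linarith
    moreover have "cnt n y j \<le> cnt n y 1 - s * (1 + f / 15)" if "j \<noteq> 1" for j
    proof -
      have "expected_cnt n x 1 - expected_cnt n x j \<ge> s * (1 + f * (1 - f))"
        using expected_cnt_gap_ge[OF n0 s gap that] by (simp add: f_def)
      then have "expected_cnt n x 1 - expected_cnt n x j \<ge> s + s * f * (1 - f)" by (simp add: algebra_simps)
      moreover have "s * (1 + f / 15) = s + s * f / 15" by (simp add: algebra_simps)
      ultimately show ?thesis using y1 yj[of j] dd q by linarith
    qed
    ultimately show ?thesis by blast
  qed
  have "measure_pmf.prob ?R
      (- {y. cnt n y 1 \<ge> a \<and> (\<forall>j. j \<noteq> 1 \<longrightarrow> cnt n y j \<le> cnt n y 1 - s * (1 + f / 15))})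
      \<le> measure_pmf.prob ?R (A \<union> (\<Union>j\<in>x ` {..<n}. B j))"
    \<comment> \<open>Inclusion holds only on the support, as the bound for absent colours relies on
      it.\<close>
    by (intro measure_pmf.finite_measure_mono_AE) (use good in \<open>auto simp: AE_measure_pmf_iff\<close>)
  also have "\<dots> \<le> measure_pmf.prob ?R A + measure_pmf.prob ?R (\<Union>j\<in>x ` {..<n}. B j)"
    by (intro measure_Un_le) auto
  also have "measure_pmf.prob ?R (\<Union>j\<in>x ` {..<n}. B j) \<le> (\<Sum>j\<in>x ` {..<n}. measure_pmf.prob ?R (B j))"
    by (intro measure_pmf.finite_measure_subadditive_finite) auto
  also have "\<dots> \<le> (\<Sum>j\<in>x ` {..<n}. 1 / N ^ 4)"
    unfolding B_def by (intro sum_mono tail) simp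
  also have "\<dots> = real (card (x ` {..<n})) * (1 / N ^ 4)" by simp
  also have "\<dots> \<le> N * (1 / N ^ 4)"
    using card_image_le[of "{..<n}" x] N by (intro mult_right_mono) (auto simp: N_def)
  also have "measure_pmf.prob ?R A \<le> 1 / N ^ 4" unfolding A_def by (intro tail) simp
  also have "1 / N ^ 4 + N * (1 / N ^ 4) \<le> 2 / N ^ 3"
    using N by (simp add: field_simps power4_eq_xxxx power3_eq_cube)
  finally show ?thesis by (simp add: a_def N_def)
qed

text \<open>Markov's inequality in inductive form: without consensus at least one node is missing,
  so the minority size bounds failure at \<open>T = 0\<close>, and it contracts by
  \<open>22/25\<close> per round on average. The cost of possibly leaving the region is rounded up
  to the \<open>2 / n ^ 3\<close> of \<open>bias_round\<close>.\<close>

lemma miss_near_consensus: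
  assumes n: "n > 0" "6000 * ln (real n) \<le> real n"
  shows "cnt n x 1 \<ge> 3/5 * real n \<Longrightarrow>
    miss n T x \<le> real T * (2 / real n ^ 3) + (22/25) ^ T * (real n - cnt n x 1)"
proof (induction T arbitrary: x)
  case 0
  have "1 \<le> real n - cnt n x 1" if "configuration_of n x 1 \<noteq> n"
  proof -
    have "configuration_of n x 1 < n" using that cnt_le[of n x 1] by simp
    then show ?thesis by linarith
  qed
  then show ?case by (simp add: miss_0)
next
  case (Suc T)
  let ?R = "majority_round n x"
  let ?g = "\<lambda>y. real T * (2 / real n ^ 3) + (22/25) ^ T * (real n - cnt n y 1)"
  have "measure_pmf.prob ?R (- {y. cnt n y 1 \<ge> 3/5 * real n}) \<le> 2 / real n ^ 3"
    by (rule order_trans[OF consensus_round(1)[OF n Suc.prems]]) (simp add: divide_right_mono)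
  then have "miss n (Suc T) x \<le> 2 / real n ^ 3 + measure_pmf.expectation ?R ?g"
    by (rule miss_step[OF n(1)]) (use Suc.IH in \<open>auto intro!: add_nonneg_nonneg simp: configuration_of_le\<close>)
  also have "measure_pmf.expectation ?R ?g = real T * (2 / real n ^ 3)
      + (22/25) ^ T * measure_pmf.expectation ?R (\<lambda>y. real n - cnt n y 1)"
    by (subst Bochner_Integration.integral_add)
      (auto intro!: integrable_measure_pmf_finite finite_set_majority_round n)
  also have "(22/25) ^ T * measure_pmf.expectation ?R (\<lambda>y. real n - cnt n y 1) \<le>
      (22/25) ^ T * (22/25 * (real n - cnt n x 1))"
    by (intro mult_left_mono consensus_round n Suc.prems) auto
  finally show ?case by (simp add: algebra_simps add_divide_distrib)
qed

text \<open>The induction generalises over \<open>s\<close>, which grows by at least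
  \<open>1 + 1 / (15 * lam)\<close> per good round while \<open>c\<^sub>1\<close> does not drop. The
  last premise is a budget: exhausted at \<open>T1 = 0\<close>, it would force \<open>s > n\<close>,
  so the growth phase must have ended before. \<open>T2\<close> rounds stay reserved for the
  endgame.\<close>

lemma miss_biased:
  assumes n: "n > 1" "6000 * ln (real n) \<le> real n" and lam: "lam \<ge> 1"
  shows "cnt n x 1 \<ge> real n / lam \<Longrightarrow> s \<ge> 24 * sqrt (2 * lam * real n * ln (real n)) \<Longrightarrow>
    (\<And>j. j \<noteq> 1 \<Longrightarrow> cnt n x j \<le> cnt n x 1 - s) \<Longrightarrow> s * (1 + 1 / (15 * lam)) ^ T1 > real n \<Longrightarrow>
    miss n (T1 + T2) x \<le> real (T1 + T2) * (2 / real n ^ 3) + (22/25) ^ T2 * real n"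
proof (induction T1 arbitrary: x s)
  case (0 x s)
  \<comment> \<open>Any colour other than 1 would do: its count is non-negative.\<close>
  have "s \<le> cnt n x 1" using "0.prems"(3)[of 2] by simp
  then show ?case using "0.prems"(4) cnt_le[of n x 1] by simp
next
  case (Suc T1)
  note c = Suc.prems(1) and s = Suc.prems(2) and gap = Suc.prems(3) and long = Suc.prems(4)
  define f where "f = cnt n x 1 / real n"
  have n0: "n > 0" and lnn: "ln (real n) > 0" using n by auto
  show ?case
  proof (cases "f \<le> 3/5")
    case False
    then have "cnt n x 1 \<ge> 3/5 * real n" using n by (simp add: f_def field_simps)
    from miss_near_consensus[OF n0 n(2) this, of "Suc T1 + T2"]
    have "miss n (Suc T1 + T2) x \<le> real (Suc T1 + T2) * (2 / real n ^ 3)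
      + (22/25) ^ (Suc T1 + T2) * (real n - cnt n x 1)" .
    moreover have "(22/25) ^ (Suc T1 + T2) * (real n - cnt n x 1) \<le> (22/25) ^ T2 * real n"
      by (intro mult_mono power_decreasing) (auto simp: configuration_of_le)
    ultimately show ?thesis by linarith
  next
    case True
    have s_sq: "s\<^sup>2 \<ge> 1152 * lam * real n * ln (real n)" and s0: "s \<ge> 0"
    proof -
      have "0 \<le> 24 * sqrt (2 * lam * real n * ln (real n))" using lam lnn by simp
      then show "s \<ge> 0" using s by linarith
      have "(24 * sqrt (2 * lam * real n * ln (real n)))\<^sup>2 \<le> s\<^sup>2"
        using s lam lnn by (intro power_mono) auto
      then show "s\<^sup>2 \<ge> 1152 * lam * real n * ln (real n)"
        using lam lnn by (simp add: power_mult_distrib)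
    qed
    have sc: "s \<le> cnt n x 1" using gap[of 2] by simp
    have f: "f \<ge> 1 / lam" using c n lam by (simp add: f_def field_simps)
    then have lf: "lam * f \<ge> 1" using lam by (simp add: field_simps)
    have f0: "f \<ge> 0" by (simp add: f_def)
    have cf: "cnt n x 1 = f * real n" using n by (simp add: f_def)
    \<comment> \<open>Via \<open>s \<le> c\<^sub>1\<close> this keeps the deviation \<open>d\<close>
      of \<open>bias_round\<close> within the Chernoff range.\<close>
    have "2 * ln (real n) \<le> s"
    proof (rule power2_le_imp_le[OF _ s0])
      have "(2 * ln (real n))\<^sup>2 = 4 * ln (real n) * ln (real n)" by (simp add: power2_eq_square)
      also have "\<dots> \<le> (1152 * lam) * real n * ln (real n)"
        using lam lnn n by (intro mult_mono ln_bound) auto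
      finally show "(2 * ln (real n))\<^sup>2 \<le> s\<^sup>2" using s_sq by simp
    qed
    then have c2: "2 * ln (real n) \<le> cnt n x 1" using sc by linarith
    \<comment> \<open>The constant \<open>24 \<surd>2\<close> of the theorem is used here: \<open>24\<^sup>2 * 2 = 6\<^sup>2 * 32\<close>.\<close>
    have noise: "6 * sqrt (32 * cnt n x 1 * ln (real n)) \<le> s * f"
    proof (rule power2_le_imp_le)
      have "(6 * sqrt (32 * cnt n x 1 * ln (real n)))\<^sup>2 = 1152 * (f * real n) * ln (real n) * 1"
        using lnn f0 by (simp add: power_mult_distrib cf[simplified])
      also have "\<dots> \<le> 1152 * (f * real n) * ln (real n) * (lam * f)"
        using lnn f0 lf by (intro mult_left_mono) auto
      also have "\<dots> = 1152 * lam * real n * ln (real n) * f\<^sup>2" by (simp add: power2_eq_square)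
      also have "\<dots> \<le> s\<^sup>2 * f\<^sup>2" using s_sq by (intro mult_right_mono) auto
      finally show "(6 * sqrt (32 * cnt n x 1 * ln (real n)))\<^sup>2 \<le> (s * f)\<^sup>2"
        by (simp add: power_mult_distrib)
    qed (use s0 f0 in simp)
    define \<beta> where "\<beta> = real (T1 + T2) * (2 / real n ^ 3) + (22/25) ^ T2 * real n"
    define G where "G = {y. cnt n y 1 \<ge> cnt n x 1 \<and>
      (\<forall>j. j \<noteq> 1 \<longrightarrow> cnt n y j \<le> cnt n y 1 - s * (1 + f / 15))}"
    have "measure_pmf.prob (majority_round n x) (- G) \<le> 2 / real n ^ 3"
      unfolding G_def f_def
      by (rule bias_round[OF n(1) s0 gap]) (use True c2 noise in \<open>auto simp: f_def\<close>)
    then have "miss n (Suc (T1 + T2)) x \<le>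
        2 / real n ^ 3 + measure_pmf.expectation (majority_round n x) (\<lambda>_. \<beta>)"
    proof (rule miss_step[OF n0])
      fix y assume y: "y \<in> G"
      have "s * (1 + 1 / (15 * lam)) \<le> s * (1 + f / 15)"
        using f s0 by (intro mult_left_mono) auto
      then have "s * (1 + 1 / (15 * lam)) * (1 + 1 / (15 * lam)) ^ T1 \<le>
          s * (1 + f / 15) * (1 + 1 / (15 * lam)) ^ T1"
        using lam by (intro mult_right_mono) auto
      then have "real n < s * (1 + f / 15) * (1 + 1 / (15 * lam)) ^ T1"
        using long by (simp add: mult.assoc)
      moreover have "s * 1 \<le> s * (1 + f / 15)" using s0 f0 by (intro mult_left_mono) auto
      ultimately show "miss n (T1 + T2) y \<le> \<beta>"
        unfolding \<beta>_def using y s c by (intro Suc.IH[where s = "s * (1 + f / 15)"]) (auto simp: G_def)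
    qed (simp add: \<beta>_def)
    then show ?thesis by (simp add: \<beta>_def algebra_simps add_divide_distrib)
  qed
qed

theorem theorem3p1:
  "\<exists>C c0 :: real. \<exists>n0 :: nat. C > 0 \<and> c0 > 0 \<and>
    (\<forall>n k :: nat. \<forall>lam :: real. \<forall>(c :: configuration) (x :: coloring).
      n \<ge> n0 \<longrightarrow>
      0 < lam \<longrightarrow> lam < root 3 (real n) \<longrightarrow>
      is_configuration n k c \<longrightarrow>
      antimono_on {1..k} c \<longrightarrow>
      real (c 1) \<ge> real n / lam \<longrightarrow>
      bias c \<ge> 24 * sqrt (2 * lam * real n * ln (real n)) \<longrightarrow>
      configuration_of n x = c \<longrightarrow>
      measure_pmf.prob (trajectory n (nat \<lfloor>C * lam * ln (real n)\<rfloor>) x)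
        {xs. \<exists>y\<in>set xs. configuration_of n y 1 = n} \<ge> 1 - real n powr (- c0))"
proof -
  \<comment> \<open>These conditions serve, in order, the concentration in the endgame, the
    absorption of the total error \<open>201 / n\<close> into \<open>n powr (- 1/2)\<close>, and the
    rounding of round numbers.\<close>
  have "eventually (\<lambda>n. 6000 * ln (real n) \<le> real n \<and> 201 / real n \<le> real n powr (- (1/2)) \<and> 1 \<le> ln (real n))
      sequentially"
    by (intro eventually_conj; real_asymp)
  then obtain n0 where n0: "6000 * ln (real n) \<le> real n" "201 / real n \<le> real n powr (- (1/2))"
    "1 \<le> ln (real n)" if "n \<ge> n0" for n
    unfolding eventually_sequentially by blast
  show ?thesis
  proof (rule exI[of _ 100], rule exI[of _ "1/2"], rule exI[of _ n0], intro conjI allI impI)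
    fix n k lam and c :: configuration and x :: coloring
    assume n: "n \<ge> n0" and lam: "0 < lam" "lam < root 3 (real n)" and conf: "is_configuration n k c"
      and anti: "antimono_on {1..k} c" and c1: "real (c 1) \<ge> real n / lam"
      and bias: "bias c \<ge> 24 * sqrt (2 * lam * real n * ln (real n))"
      and x: "configuration_of n x = c"
    define L where "L = ln (real n)"
    have L: "L \<ge> 1" using n0(3)[OF n] by (simp add: L_def)
    have n1: "n > 1"
    proof (rule ccontr)
      assume "\<not> n > 1"
      then have "n = 0 \<or> n = 1" by linarith
      then show False using L by (auto simp: L_def)
    qed
    have lam1: "lam \<ge> 1"
    proof -
      have "real n / lam \<le> real n" using c1 cnt_le[of n x 1] x by simp
      then show ?thesis using n1 lam by (simp add: field_simps)
    qed
    have "root 3 (real n) \<le> real n"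
      using n1 real_root_le_mono[of 3 "real n" "real n ^ 3"] by (simp add: real_root_power_cancel self_le_power)
    then have lamn: "lam \<le> real n" using lam by linarith
    have gap: "cnt n x j \<le> cnt n x 1 - bias c" if "j \<noteq> 1" for j
    proof -
      \<comment> \<open>Colours outside \<open>{1..k}\<close>, including colour 0, have count 0; for
        \<open>k = 1\<close> this covers every \<open>j \<noteq> 1\<close>.\<close>
      have "c j \<le> c 2"
      proof (cases "j \<in> {1..k}")
        case True
        then show ?thesis using that by (intro monotone_onD[OF anti, of 2 j]) auto
      next
        case False
        then show ?thesis using conf by (simp add: is_configuration_def)
      qed
      then show ?thesis by (simp add: x bias_def)
    qed
    define T where "T = nat \<lfloor>100 * lam * L\<rfloor>"
    \<comment> \<open>As \<open>22/25 \<le> exp (- 3/25)\<close> and \<open>20 * 3/25 > 2\<close>,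
      the endgame factor is at most \<open>1 / n ^ 2\<close>.\<close>
    define T2 where "T2 = nat \<lceil>20 * L\<rceil>"
    define T1 where "T1 = T - T2"
    have lamL: "lam * L \<ge> L" "L \<ge> 1" using lam1 L by (auto simp: mult_right_mono[of 1 lam L, simplified])
    have T: "real T \<le> 100 * lam * L" "real T \<ge> 100 * lam * L - 1"
      using lamL by (auto simp: T_def of_nat_floor)
    have T2: "real T2 \<ge> 20 * L" "real T2 \<le> 20 * L + 1" using L by (auto simp: T2_def)
    have "real T2 \<le> real T" using T T2 lamL by linarith
    then have T12: "T = T1 + T2" "real T1 = real T - real T2" by (auto simp: T1_def of_nat_diff)
    have T1: "real T1 \<ge> 30 * lam * L" using T T2 T12 lamL by linarith
    have "bias c > 1"
    proof -
      have "1 * 1 * 1 \<le> (2 * lam) * real n * L" using lam1 L n1 by (intro mult_mono) auto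
      then have "1 \<le> sqrt (2 * lam * real n * L)" by (intro real_sqrt_ge_one) simp
      then show ?thesis using bias unfolding L_def by linarith
    qed
    moreover have "real n \<le> (1 + 1 / (15 * lam)) ^ T1"
    proof -
      \<comment> \<open>Here \<open>ln (1 + u) \<ge> u - u\<^sup>2 \<ge> u / 2\<close>, so
        \<open>30 * lam * L\<close> rounds multiply the gap by at least \<open>exp L = n\<close>; a
        start above 1 then exceeds \<open>n\<close>.\<close>
      define u where "u = 1 / (15 * lam)"
      have u: "0 < u" "u \<le> 1/2" using lam1 by (auto simp: u_def field_simps)
      have "u * u \<le> u * (1/2)" using u by (intro mult_left_mono) auto
      then have "u / 2 \<le> ln (1 + u)"
        using ln_one_plus_pos_lower_bound[of u] u unfolding power2_eq_square by linarith
      have "L = 30 * lam * L * (u / 2)" using lam1 by (simp add: u_def)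
      also have "\<dots> \<le> real T1 * ln (1 + u)"
        using T1 u \<open>u / 2 \<le> ln (1 + u)\<close> lam1 L by (intro mult_mono) auto
      also have "\<dots> = ln ((1 + u) ^ T1)" using u by (simp add: ln_realpow)
      finally have "ln (real n) \<le> ln ((1 + u) ^ T1)" by (simp add: L_def)
      moreover have "(1 + u) ^ T1 > 0" using u by simp
      ultimately show ?thesis using n1 ln_le_cancel_iff[of "real n" "(1 + u) ^ T1"] unfolding u_def by simp
    qed
    ultimately have "bias c * (1 + 1 / (15 * lam)) ^ T1 > real n"
      using n1 mult_less_le_imp_less[of 1 "bias c" "real n" "(1 + 1 / (15 * lam)) ^ T1"] by linarith
    moreover have "cnt n x 1 \<ge> real n / lam" using c1 x by simp
    ultimately have "miss n T x \<le> real T * (2 / real n ^ 3) + (22/25) ^ T2 * real n"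
      unfolding T12(1) by (intro miss_biased[OF n1 n0(1)[OF n] lam1 _ bias gap])
    also have "real T * (2 / real n ^ 3) \<le> 200 / real n"
    proof -
      \<comment> \<open>A polynomial bound on \<open>T\<close> suffices: at most
        \<open>100 * n\<^sup>2\<close> rounds, each with error \<open>2 / n ^ 3\<close>.\<close>
      have "lam * L \<le> real n * real n"
        unfolding L_def using lamn n1 lam by (intro mult_mono ln_bound) auto
      then have "real T \<le> 100 * (real n * real n)" using T(1) by linarith
      then have "real T * (2 / real n ^ 3) \<le> 100 * (real n * real n) * (2 / real n ^ 3)"
        by (intro mult_right_mono) auto
      then show ?thesis using n1 by (simp add: power3_eq_cube)
    qed
    also have "(22/25) ^ T2 * real n \<le> 1 / real n"
    proof -
      have "(22/25 :: real) ^ T2 \<le> exp (- 3/25) ^ T2"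
        using exp_ge_add_one_self[of "- 3/25"] by (intro power_mono) auto
      also have "\<dots> = exp (- (3/25 * real T2))" by (simp flip: exp_of_nat_mult)
      also have "\<dots> \<le> exp (- (2 * L))" using T2 L by simp
      also have "\<dots> = 1 / real n ^ 2"
        using n1 exp_minus_mult_ln[of "real n" 2] by (simp add: L_def)
      finally have "(22/25) ^ T2 * real n \<le> 1 / real n ^ 2 * real n" by (intro mult_right_mono) auto
      then show ?thesis using n1 by (simp add: power2_eq_square)
    qed
    also have "200 / real n + 1 / real n = 201 / real n" by (simp flip: add_divide_distrib)
    finally have "miss n T x \<le> real n powr (- (1/2))" using n0(2)[OF n] by simp
    then show "measure_pmf.prob (trajectory n (nat \<lfloor>100 * lam * ln (real n)\<rfloor>) x)
        {xs. \<exists>y\<in>set xs. configuration_of n y 1 = n} \<ge> 1 - real n powr (- (1/2))"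
      unfolding prob_trajectory_eq by (simp add: T_def L_def)
  qed simp_all
qed

end
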